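(* Assume that for every $\xi$ the operator $F_\xi$ is $L_\xi$-Lipschitz with $L_\xi>0$, and that there is a (possibly negative) $\mu_\xi\in\mathbb{R}$ with $\langle F_\xi(x)-F_\xi(x^* ),x-x^*\rangle\ge\mu_\xi\|x-x^*\|^2$ for all $x\in\mathbb{R}^d$. Let $\gamma_\xi>0$ satisfy $$\mathbb{E}_{\xi}[\gamma_{\xi}F_{\xi}(x^* )]=0,\qquad \mathbb{E}_{\xi}\left[\gamma_{\xi}\mu_{\xi}\left(\mathbf{1}_{\{\mu_{\xi}\ge0\}}+4\cdot\mathbf{1}_{\{\mu_{\xi}<0\}}\right)\right]\ge0,\qquad \gamma_{\xi}\le\frac{1}{4|\mu_{\xi}|+\sqrt2 L_{\xi}},$$ and assume that $$\widetilde\rho=\frac18\mathbb{E}_{\xi}\left[\gamma_{\xi}\mu_{\xi}\left(\mathbf{1}_{\{\mu_{\xi}\ge0\}}+4\cdot\mathbf{1}_{\{\mu_{\xi}<0\}}\right)\right]>0.$$ Let $K\ge0$, $k_0=\lceil K/2\rceil$, and define $\{\beta_k\}_{k\ge0}$ by: $\beta_k=1$ if $K\le 1/\widetilde\rho$; $\beta_k=1$ if $K>1/\widetilde\rho$ and $k<k_0$; $\beta_k=\dfrac{2}{2+\widetilde\rho(k-k_0)}$ if $K>1/\widetilde\rho$ and $k\ge k_0$. Then the iterates of S-SEG with stepsizes $\gamma_{1,\xi^k}=\beta_k\gamma_{\xi^k}$ and $\gamma_{2,\xi^k}=\frac14\gamma_{1,\xi^k}$ satisfy $$\mathbb{E}\left[\|x^K-x^*\|^2\right]\le\frac{32\|x^0-x^*\|^2}{\widetilde\rho}\exp\left(-\frac{\widetilde\rho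 K}{2}\right)+\frac{27\sigma_{AS}^2}{\widetilde\rho^2K},\qquad \sigma_{AS}^2=\mathbb{E}_\xi\left[\gamma_\xi^2\|F_\xi(x^* )\|^2\right].$$
   Context: $F:\mathbb{R}^d\to\mathbb{R}^d$ is an operator, $x^*\in\mathbb{R}^d$ satisfies $F(x^* )=0$, $\|\cdot\|$ is the Euclidean norm. $F_\xi:\mathbb{R}^d\to\mathbb{R}^d$ are stochastic realizations indexed by a random variable $\xi$; $\xi^0,\xi^1,\dots$ are independent copies of $\xi$. $\mathbf{1}_{\{\cdot\}}$ is the indicator of a condition. Same-sample stochastic extragradient (S-SEG), started at a deterministic $x^0\in\mathbb{R}^d$, is $$x^{k+1}=x^k-\gamma_{2,\xi^k}F_{\xi^k}\left(x^k-\gamma_{1,\xi^k}F_{\xi^k}(x^k)\right),\quad k\ge0,$$ where the same sample $\xi^k$ is used twice and the stepsizes may depend on the sample and on $k$. *)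

theory Defs
  imports "HOL-Probability.Probability"
begin

text \<open>
  The stepsizes and the operators are functions of the sample, and \<open>z k\<close> is the sample
  drawn in step \<open>k\<close>; both operator calls of a step use the same sample.
\<close>

primrec s_seg ::
  "('s \<Rightarrow> 'a \<Rightarrow> 'a) \<Rightarrow> (nat \<Rightarrow> 's \<Rightarrow> real) \<Rightarrow> (nat \<Rightarrow> 's \<Rightarrow> real) \<Rightarrow> 'a \<Rightarrow> (nat \<Rightarrow> 's)
    \<Rightarrow> nat \<Rightarrow> 'a::real_vector"
where
  "s_seg G \<gamma>1 \<gamma>2 x0 z 0 = x0"
| "s_seg G \<gamma>1 \<gamma>2 x0 z (Suc k) =
     (let x = s_seg G \<gamma>1 \<gamma>2 x0 z k
      in x - \<gamma>2 k (z k) *\<^sub>R G (z k) (x - \<gamma>1 k (z k) *\<^sub>R G (z k) x))"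

definition seg_beta :: "real \<Rightarrow> nat \<Rightarrow> nat \<Rightarrow> real" where
  "seg_beta \<rho> K k =
     (let k0 = nat \<lceil>real K / 2\<rceil>
      in if real K \<le> 1 / \<rho> then 1
         else if k < k0 then 1
         else 2 / (2 + \<rho> * (real k - real k0)))"

end

theory Submission
  imports Defs
begin

text \<open>
  Write \<open>e = x - x\<^sup>*\<close>, \<open>w = \<gamma>\<^sub>\<xi> \<mu>\<^sub>\<xi>\<close> and \<open>m = w (1\<^bsub>w \<ge> 0\<^esub> + 4 \<cdot> 1\<^bsub>w < 0\<^esub>)\<close>, so that
  \<open>8 \<rho> = E[m]\<close>. With step factor \<open>\<beta> \<le> 1\<close>, one step satisfies for every single sample
  \<open>|e'|\<^sup>2 \<le> |e|\<^sup>2 - (\<beta>/4) m |e|\<^sup>2 - (\<beta>/2) \<langle>\<gamma>\<^sub>\<xi> F\<^sub>\<xi>(x\<^sup>*), e\<rangle> + (3/4) \<beta>\<^sup>2 \<gamma>\<^sub>\<xi>\<^sup>2 |F\<^sub>\<xi>(x\<^sup>*)|\<^sup>2\<close>.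
  The terms of second order are absorbed because the extrapolated direction \<open>v\<close> and the plain
  direction \<open>u\<close> are close: polarisation turns \<open>- \<langle>v, u\<rangle>\<close> into negative multiples of
  \<open>|u|\<^sup>2\<close> and \<open>|v|\<^sup>2\<close>, and the stepsize restriction keeps the total coefficient of
  \<open>|u|\<^sup>2\<close> nonpositive (\<open>extragradient_step_bound\<close>).

  Taking expectations removes the inner product, since \<open>\<gamma>\<^sub>\<xi> F\<^sub>\<xi>(x\<^sup>*)\<close> has mean zero, and
  replaces \<open>m/4\<close> by \<open>2 \<rho>\<close>; half of this is given away
  (\<open>expected_extragradient_step_bound\<close>). As \<open>\<xi>\<^sup>k\<close> is independent of the iterate \<open>x\<^sup>k\<close>,
  Fubini on the product of the sample laws yields
  \<open>r\<^bsub>k+1\<^esub> \<le> (1 - \<rho> \<beta>\<^sub>k) r\<^sub>k + (3/4) \<beta>\<^sub>k\<^sup>2 \<sigma>\<^sup>2\<close> for \<open>r\<^sub>k = E|x\<^sup>k - x\<^sup>*|\<^sup>2\<close>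
  (\<open>s_seg_second_moment_Suc\<close>).

  What is left is about real sequences (\<open>seg_beta_recurrence\<close>). A run with \<open>K \<le> 1/\<rho>\<close> is so
  short that the noise accumulated with \<open>\<beta> = 1\<close> is harmless. In the first half of a longer run
  \<open>\<beta> = 1\<close> shrinks the initial error to \<open>exp(-\<rho>K/2) r\<^sub>0\<close> plus a noise floor of order
  \<open>\<sigma>\<^sup>2/\<rho>\<close>; in the second half the decreasing steps make \<open>(2 + \<rho>(j-1))\<^sup>2 r\<close> grow by at most
  \<open>3 \<sigma>\<^sup>2\<close> per step, and division by the weight, of order \<open>(\<rho>K)\<^sup>2\<close>, turns the floor into
  \<open>\<sigma>\<^sup>2/(\<rho>\<^sup>2 K)\<close>.
\<close>

section \<open>One step for a fixed sample\<close>

text \<open>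
  Here \<open>u\<close>, \<open>v\<close> and \<open>a\<close> are the scaled operator values at the current point, at the extrapolated
  point (whose error is \<open>e - u\<close>) and at the solution. The factor \<open>1/4\<close> in front of the drift
  cannot be replaced by the smaller \<open>1/8\<close> when \<open>w < 0\<close>: for \<open>u = w e\<close>, \<open>v = w (1 - w) e\<close>, \<open>a = 0\<close>
  and \<open>e \<noteq> 0\<close> the squared norm is \<open>(1 - w (1 - w) / 4)\<^sup>2 |e|\<^sup>2\<close>, which exceeds \<open>(1 - w / 2) |e|\<^sup>2\<close>. The loss of
  a factor two is therefore taken only after averaging, when the drift has a sign.
\<close>

lemma extragradient_step_bound:
  fixes e u v a :: "'a::real_inner" and w t :: real
  assumes lip: "norm (u - v) \<le> t * norm u"
    and mono: "inner (v - a) (e - u) \<ge> w * (norm (e - u))\<^sup>2"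
    and t: "t \<ge> 0"
    and small: "4 * \<bar>w\<bar> + sqrt 2 * t \<le> 1"
  shows "(norm (e - (1/4) *\<^sub>R v))\<^sup>2
       \<le> (norm e)\<^sup>2 - 1/4 * (w * (of_bool (w \<ge> 0) + 4 * of_bool (w < 0))) * (norm e)\<^sup>2
         - 1/2 * inner a e + 3/4 * (norm a)\<^sup>2"
proof -
  let ?m = "w * (of_bool (w \<ge> 0) + 4 * of_bool (w < 0))"
  have expand: "(norm (e - (1/4) *\<^sub>R v))\<^sup>2 = (norm e)\<^sup>2 - 1/2 * inner v e + (norm v)\<^sup>2 / 16"
    by (simp add: power2_norm_eq_inner algebra_simps inner_commute)
  have split: "inner v e = inner (v - a) (e - u) + inner v u - inner a u + inner a e"
    by (simp add: algebra_simps)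
  have polar: "inner v u = ((norm u)\<^sup>2 + (norm v)\<^sup>2 - (norm (u - v))\<^sup>2) / 2"
    by (simp add: power2_norm_eq_inner algebra_simps inner_commute)
  \<comment> \<open>Half of the last term becomes the noise term of the conclusion.\<close>
  have young: "inner a u \<le> (norm u)\<^sup>2 / 6 + 3/2 * (norm a)\<^sup>2"
    using inner_ge_zero[of "u - 3 *\<^sub>R a"]
    by (simp add: power2_norm_eq_inner algebra_simps inner_commute)
  \<comment> \<open>Without the surplus \<open>- 3/16 * (norm v)\<^sup>2\<close>, here turned into a multiple of \<open>(norm u)\<^sup>2\<close>, that term would keep a positive coefficient for \<open>\<bar>w\<bar>\<close> near \<open>1/4\<close>.\<close>
  have v_large: "(norm v)\<^sup>2 \<ge> (norm u)\<^sup>2 / 2 - (norm (u - v))\<^sup>2"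
    using inner_ge_zero[of "u - 2 *\<^sub>R v"]
    by (simp add: power2_norm_eq_inner algebra_simps inner_commute)
  have uv: "(norm (u - v))\<^sup>2 \<le> t\<^sup>2 * (norm u)\<^sup>2"
    using power_mono[OF lip, of 2] by (simp add: power_mult_distrib)
  have drift: "- (w * (norm (e - u))\<^sup>2 / 2)
      \<le> - (1/4 * ?m * (norm e)\<^sup>2) + \<bar>w\<bar> * (norm u)\<^sup>2"
  proof (cases "w \<ge> 0")
    case True
    have "(norm (e - u))\<^sup>2 \<ge> (norm e)\<^sup>2 / 2 - (norm u)\<^sup>2"
      using inner_ge_zero[of "e - 2 *\<^sub>R u"]
      by (simp add: power2_norm_eq_inner algebra_simps inner_commute)
    from mult_left_mono[OF this True] have
      "w * (norm e)\<^sup>2 / 2 - w * (norm u)\<^sup>2 \<le> w * (norm (e - u))\<^sup>2"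
      by (simp only: right_diff_distrib times_divide_eq_right)
    moreover have "w * (norm u)\<^sup>2 \<ge> 0" using True by simp
    ultimately have "- (w * (norm (e - u))\<^sup>2 / 2) \<le> - (w * (norm e)\<^sup>2 / 4) + w * (norm u)\<^sup>2"
      by argo
    then show ?thesis using True by simp
  next
    case False
    have "(norm (e - u))\<^sup>2 \<le> 2 * (norm e)\<^sup>2 + 2 * (norm u)\<^sup>2"
      using inner_ge_zero[of "e + u"]
      by (simp add: power2_norm_eq_inner algebra_simps inner_commute)
    from mult_left_mono[OF this, of "- w"] have
      "- (w * (norm (e - u))\<^sup>2) \<le> - 2 * (w * (norm e)\<^sup>2) - 2 * (w * (norm u)\<^sup>2)"
      using False by (simp add: algebra_simps)
    then show ?thesis using False by (simp add: algebra_simps)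
  qed
  \<comment> \<open>The coefficient of \<open>(norm u)\<^sup>2\<close> will be \<open>\<bar>w\<bar> - 1/6 - 3/32 + 7/16 * t\<^sup>2\<close>, where \<open>25/96 = 1/6 + 3/32\<close>.\<close>
  have "(sqrt 2 * t)\<^sup>2 \<le> (1 - 4 * \<bar>w\<bar>)\<^sup>2"
    using small t by (intro power_mono) auto
  then have t2: "2 * t\<^sup>2 \<le> 1 - 8 * \<bar>w\<bar> + 16 * \<bar>w\<bar>\<^sup>2"
    by (simp add: power_mult_distrib power2_diff algebra_simps)
  have "0 \<le> sqrt 2 * t" using t by simp
  then have w4: "\<bar>w\<bar> \<le> 1/4" using small by linarith
  then have "\<bar>w\<bar> * \<bar>w\<bar> \<le> \<bar>w\<bar> * (1/4)" by (intro mult_left_mono) auto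
  then have "\<bar>w\<bar> + 7/16 * t\<^sup>2 \<le> 25/96"
    using t2 w4 by (simp only: power2_eq_square)
  from mult_right_mono[OF this, of "(norm u)\<^sup>2"]
  have coeff: "\<bar>w\<bar> * (norm u)\<^sup>2 + 7/16 * (t\<^sup>2 * (norm u)\<^sup>2) \<le> 25/96 * (norm u)\<^sup>2"
    by (simp add: algebra_simps)
  have "- (inner v e / 2) + (norm v)\<^sup>2 / 16
      \<le> - (w * (norm (e - u))\<^sup>2 / 2) - (norm u)\<^sup>2 / 6 + (norm (u - v))\<^sup>2 / 4
        - 3/16 * (norm v)\<^sup>2 - 1/2 * inner a e + 3/4 * (norm a)\<^sup>2"
    using split polar young mono by argo
  moreover have "- ((norm u)\<^sup>2 / 6) + (norm (u - v))\<^sup>2 / 4 - 3/16 * (norm v)\<^sup>2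
      \<le> - (25/96 * (norm u)\<^sup>2) + 7/16 * (t\<^sup>2 * (norm u)\<^sup>2)"
    using v_large uv by argo
  moreover define P where "P = 1/4 * ?m * (norm e)\<^sup>2"
  moreover define W where "W = \<bar>w\<bar> * (norm u)\<^sup>2"
  ultimately have "(norm (e - (1/4) *\<^sub>R v))\<^sup>2 \<le> (norm e)\<^sup>2 - P - 1/2 * inner a e + 3/4 * (norm a)\<^sup>2"
    using expand drift[folded P_def W_def] coeff[folded W_def] by argo
  then show ?thesis by (simp only: P_def)
qed

section \<open>Measurability and independence of the iterates\<close>

text \<open>
  A Caratheodory function, measurable in the sample and continuous in the point, may be evaluated
  along measurable arguments: approximate the point by simple functions, for which only finitely
  many values occur, and pass to the limit by continuity.
\<close>

lemma borel_measurable_caratheodory: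
  fixes G :: "'s \<Rightarrow> 'a::{metric_space, second_countable_topology} \<Rightarrow> 'b::metric_space"
  assumes G: "\<And>x. (\<lambda>s. G s x) \<in> borel_measurable D"
    and cont: "\<And>s. s \<in> space D \<Longrightarrow> continuous_on UNIV (G s)"
    and f: "f \<in> measurable N D"
    and g: "g \<in> borel_measurable N"
  shows "(\<lambda>p. G (f p) (g p)) \<in> borel_measurable N"
proof -
  obtain U where U: "\<And>i. simple_function N (U i)"
    and lim: "\<And>p. p \<in> space N \<Longrightarrow> (\<lambda>i. U i p) \<longlonglongrightarrow> g p"
    using borel_measurable_implies_sequence_metric[OF g, of undefined] by blast
  show ?thesis
  proof (rule borel_measurable_LIMSEQ_metric)
    fix i
    have fin: "finite (U i ` space N)" using U[of i] by (rule simple_functionD)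
    have U_meas: "U i \<in> measurable N (count_space (U i ` space N))"
      using U[of i] fin by (subst measurable_count_space_eq2) (auto simp: simple_function_def)
    have "(\<lambda>p. G (f p) x) \<in> borel_measurable N" for x
      using f G by (rule measurable_compose)
    from this U_meas countable_finite[OF fin] show "(\<lambda>p. G (f p) (U i p)) \<in> borel_measurable N"
      by (rule measurable_compose_countable')
  next
    fix p assume p: "p \<in> space N"
    then have "f p \<in> space D" using f by (rule measurable_space[rotated])
    then have "isCont (G (f p)) (g p)"
      using cont by (simp add: continuous_on_eq_continuous_at)
    then show "(\<lambda>i. G (f p) (U i p)) \<longlonglongrightarrow> G (f p) (g p)"
      by (rule isCont_tendsto_compose) (rule lim[OF p])
  qed
qed

lemma s_seg_cong:
  assumes "\<And>i. i < k \<Longrightarrow> z i = z' i"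
  shows "s_seg G \<gamma>1 \<gamma>2 x0 z k = s_seg G \<gamma>1 \<gamma>2 x0 z' k"
  using assms by (induction k) (simp_all add: Let_def)

lemma borel_measurable_s_seg:
  fixes G :: "'s \<Rightarrow> 'a::euclidean_space \<Rightarrow> 'a"
  assumes G: "\<And>x. (\<lambda>s. G s x) \<in> borel_measurable D"
    and cont: "\<And>s. s \<in> space D \<Longrightarrow> continuous_on UNIV (G s)"
    and \<gamma>1: "\<And>i. \<gamma>1 i \<in> borel_measurable D"
    and \<gamma>2: "\<And>i. \<gamma>2 i \<in> borel_measurable D"
    and I: "{..<k} \<subseteq> I"
  shows "(\<lambda>z. s_seg G \<gamma>1 \<gamma>2 x0 z k) \<in> borel_measurable (PiM I (\<lambda>_. D))"
  using I
proof (induction k)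
  case 0
  then show ?case by simp
next
  case (Suc k)
  let ?P = "PiM I (\<lambda>_. D)"
  have coord [measurable]: "(\<lambda>z. z k) \<in> measurable ?P D"
    using Suc.prems by (intro measurable_component_singleton) auto
  have [measurable]: "(\<lambda>z. s_seg G \<gamma>1 \<gamma>2 x0 z k) \<in> borel_measurable ?P"
    using Suc.prems by (intro Suc.IH) auto
  have [measurable]: "(\<lambda>z. \<gamma>1 k (z k)) \<in> borel_measurable ?P" "(\<lambda>z. \<gamma>2 k (z k)) \<in> borel_measurable ?P"
    using measurable_compose[OF coord \<gamma>1] measurable_compose[OF coord \<gamma>2] by auto
  have G_comp: "(\<lambda>z. G (z k) (g z)) \<in> borel_measurable ?P" if "g \<in> borel_measurable ?P" for g
    using G cont coord that by (rule borel_measurable_caratheodory)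
  note [measurable] = G_comp[of "\<lambda>z. s_seg G \<gamma>1 \<gamma>2 x0 z k"]
  have [measurable]: "(\<lambda>z. G (z k) (s_seg G \<gamma>1 \<gamma>2 x0 z k - \<gamma>1 k (z k) *\<^sub>R G (z k) (s_seg G \<gamma>1 \<gamma>2 x0 z k)))
      \<in> borel_measurable ?P"
    by (rule G_comp) measurable
  show ?case by (simp add: Let_def)
qed

text \<open>
  The iterate \<open>k\<close> depends only on the samples below \<open>k\<close>, so that integrating sample \<open>k\<close> first,
  with the others fixed, reduces a bound for the second moment to one for a deterministic point.
  The bound is carried as a real \<open>b\<close>, which makes finiteness of the moment part of the induction.
\<close>

lemma s_seg_second_moment_Suc:
  fixes G :: "'s \<Rightarrow> 'a::euclidean_space \<Rightarrow> 'a"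
  assumes D: "prob_space D"
    and G: "\<And>x. (\<lambda>s. G s x) \<in> borel_measurable D"
    and cont: "\<And>s. s \<in> space D \<Longrightarrow> continuous_on UNIV (G s)"
    and \<gamma>1: "\<And>i. \<gamma>1 i \<in> borel_measurable D"
    and \<gamma>2: "\<And>i. \<gamma>2 i \<in> borel_measurable D"
    and q: "0 \<le> q" and c: "0 \<le> c"
    and step: "\<And>x. (\<integral>\<^sup>+s. ennreal ((norm (x - \<gamma>2 k s *\<^sub>R G s (x - \<gamma>1 k s *\<^sub>R G s x) - y))\<^sup>2) \<partial>D)
        \<le> ennreal (q * (norm (x - y))\<^sup>2 + c)"
    and b: "0 \<le> b"
    and bound: "(\<integral>\<^sup>+z. ennreal ((norm (s_seg G \<gamma>1 \<gamma>2 x0 z k - y))\<^sup>2) \<partial>PiM {..<k} (\<lambda>_. D)) \<le> ennreal b"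
  shows "(\<integral>\<^sup>+z. ennreal ((norm (s_seg G \<gamma>1 \<gamma>2 x0 z (Suc k) - y))\<^sup>2) \<partial>PiM {..<Suc k} (\<lambda>_. D))
      \<le> ennreal (q * b + c)"
proof -
  interpret D: prob_space D by (rule D)
  interpret P: product_prob_space "\<lambda>_. D" by unfold_locales
  interpret Pk: prob_space "PiM {..<k} (\<lambda>_. D)" by (intro prob_space_PiM D)
  let ?x = "\<lambda>z. s_seg G \<gamma>1 \<gamma>2 x0 z k"
  note [measurable] = borel_measurable_s_seg[OF G cont \<gamma>1 \<gamma>2 order_refl, where k = k and ?x0.0 = x0]
    borel_measurable_s_seg[OF G cont \<gamma>1 \<gamma>2 order_refl, where k = "Suc k" and ?x0.0 = x0]
  have upd: "s_seg G \<gamma>1 \<gamma>2 x0 (z(k := s)) (Suc k)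
      = ?x z - \<gamma>2 k s *\<^sub>R G s (?x z - \<gamma>1 k s *\<^sub>R G s (?x z))" for z s
  proof -
    have "s_seg G \<gamma>1 \<gamma>2 x0 (z(k := s)) k = ?x z" by (rule s_seg_cong) simp
    then show ?thesis by (simp add: Let_def)
  qed
  have "(\<integral>\<^sup>+z. ennreal ((norm (s_seg G \<gamma>1 \<gamma>2 x0 z (Suc k) - y))\<^sup>2) \<partial>PiM {..<Suc k} (\<lambda>_. D))
      = (\<integral>\<^sup>+z. (\<integral>\<^sup>+s. ennreal ((norm (s_seg G \<gamma>1 \<gamma>2 x0 (z(k := s)) (Suc k) - y))\<^sup>2) \<partial>D) \<partial>PiM {..<k} (\<lambda>_. D))"
    unfolding lessThan_Suc
    by (intro P.product_nn_integral_insert)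
      (simp_all flip: lessThan_Suc del: s_seg.simps)
  also have "\<dots> \<le> (\<integral>\<^sup>+z. ennreal (q * (norm (?x z - y))\<^sup>2 + c) \<partial>PiM {..<k} (\<lambda>_. D))"
    unfolding upd by (intro nn_integral_mono step)
  also have "\<dots> = (\<integral>\<^sup>+z. ennreal q * ennreal ((norm (?x z - y))\<^sup>2) + ennreal c \<partial>PiM {..<k} (\<lambda>_. D))"
    using q c by (simp add: ennreal_plus ennreal_mult)
  also have "\<dots> = ennreal q * (\<integral>\<^sup>+z. ennreal ((norm (?x z - y))\<^sup>2) \<partial>PiM {..<k} (\<lambda>_. D)) + ennreal c"
    by (subst nn_integral_add) (auto simp: nn_integral_cmult Pk.emeasure_space_1)
  also have "\<dots> \<le> ennreal q * ennreal b + ennreal c"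
    using bound by (intro add_mono mult_left_mono) auto
  also have "\<dots> = ennreal (q * b + c)"
    using q b c by (simp add: ennreal_plus ennreal_mult)
  finally show ?thesis .
qed

text \<open>
  Independent samples with the common law \<open>D\<close> are jointly distributed by the product law, so
  expectations over the original space become integrals over a product measure.
\<close>

lemma s_seg_nn_integral_distr:
  fixes G :: "'s \<Rightarrow> 'a::euclidean_space \<Rightarrow> 'a"
  assumes M: "prob_space M"
    and indep: "prob_space.indep_vars M (\<lambda>_. D) \<xi> UNIV"
    and law: "\<And>k. distr M D (\<xi> k) = D"
    and G: "\<And>x. (\<lambda>s. G s x) \<in> borel_measurable D"
    and cont: "\<And>s. s \<in> space D \<Longrightarrow> continuous_on UNIV (G s)"
    and \<gamma>1: "\<And>i. \<gamma>1 i \<in> borel_measurable D"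
    and \<gamma>2: "\<And>i. \<gamma>2 i \<in> borel_measurable D"
    and \<phi>: "\<phi> \<in> borel_measurable borel"
  shows "(\<integral>\<^sup>+w. \<phi> (s_seg G \<gamma>1 \<gamma>2 x0 (\<lambda>k. \<xi> k w) K) \<partial>M)
      = (\<integral>\<^sup>+z. \<phi> (s_seg G \<gamma>1 \<gamma>2 x0 z K) \<partial>PiM {..<K} (\<lambda>_. D))"
\<comment> \<open>The product characterisation of independence needs a nonempty index set.\<close>
proof (cases "K = 0")
  case True
  interpret prob_space M by (rule M)
  have "prob_space D"
    using law[of 0] indep prob_space_distr[of "\<xi> 0" D] by (simp add: indep_vars_def)
  then interpret P: prob_space "PiM {..<K} (\<lambda>_. D)" by (intro prob_space_PiM)
  show ?thesis using True P.emeasure_space_1 by (simp add: emeasure_space_1)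
next
  case False
  interpret prob_space M by (rule M)
  have rv: "\<xi> k \<in> measurable M D" for k using indep by (simp add: indep_vars_def)
  have "indep_vars (\<lambda>_. D) \<xi> {..<K}" using indep by (rule indep_vars_subset) simp
  then have eq: "distr M (PiM {..<K} (\<lambda>_. D)) (\<lambda>w. \<lambda>i\<in>{..<K}. \<xi> i w) = PiM {..<K} (\<lambda>_. D)"
    using False rv by (subst (asm) indep_vars_iff_distr_eq_PiM) (auto simp: law)
  note [measurable] = borel_measurable_s_seg[OF G cont \<gamma>1 \<gamma>2 order_refl, where k = K and ?x0.0 = x0] \<phi> rv
  have "(\<integral>\<^sup>+z. \<phi> (s_seg G \<gamma>1 \<gamma>2 x0 z K) \<partial>PiM {..<K} (\<lambda>_. D))
      = (\<integral>\<^sup>+w. \<phi> (s_seg G \<gamma>1 \<gamma>2 x0 (\<lambda>i\<in>{..<K}. \<xi> i w) K) \<partial>M)"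
    by (subst eq[symmetric], subst nn_integral_distr) (auto intro: measurable_restrict)
  also have "\<dots> = (\<integral>\<^sup>+w. \<phi> (s_seg G \<gamma>1 \<gamma>2 x0 (\<lambda>k. \<xi> k w) K) \<partial>M)"
    by (intro nn_integral_cong arg_cong[where f = \<phi>] s_seg_cong) simp
  finally show ?thesis ..
qed

section \<open>One step in expectation\<close>

text \<open>
  The pointwise bound is applied with the scaled stepsize \<open>\<beta> * \<gamma> s\<close>, which is admissible because
  \<open>\<beta> \<le> 1\<close>. The inner product with \<open>x - y\<close> integrates to zero since the point is deterministic, and
  the drift coefficient drops from \<open>1/4\<close> to \<open>1/8\<close> using that the mean of \<open>m\<close> is nonnegative.
\<close>

lemma expected_extragradient_step_bound:
  fixes G :: "'s \<Rightarrow> 'a::euclidean_space \<Rightarrow> 'a" and L \<mu> \<gamma> :: "'s \<Rightarrow> real" and x y :: 'a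
  defines "m \<equiv> \<lambda>s. \<gamma> s * \<mu> s * (of_bool (\<mu> s \<ge> 0) + 4 * of_bool (\<mu> s < 0))"
  assumes D: "prob_space D"
    and lipschitz: "\<And>s. s \<in> space D \<Longrightarrow> (L s)-lipschitz_on UNIV (G s)"
    and monotone: "\<And>s x. s \<in> space D \<Longrightarrow>
          inner (G s x - G s y) (x - y) \<ge> \<mu> s * (norm (x - y))\<^sup>2"
    and \<gamma>_pos: "\<And>s. s \<in> space D \<Longrightarrow> \<gamma> s > 0"
    and small: "\<And>s. s \<in> space D \<Longrightarrow> \<gamma> s * (4 * \<bar>\<mu> s\<bar> + sqrt 2 * L s) \<le> 1"
    and m_int: "integrable D m"
    and m_nonneg: "(\<integral>s. m s \<partial>D) \<ge> 0"
    and a_int: "integrable D (\<lambda>s. \<gamma> s *\<^sub>R G s y)"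
    and unbiased: "(\<integral>s. \<gamma> s *\<^sub>R G s y \<partial>D) = 0"
    and a2_int: "integrable D (\<lambda>s. (\<gamma> s)\<^sup>2 * (norm (G s y))\<^sup>2)"
    and \<beta>: "0 < \<beta>" "\<beta> \<le> 1"
  shows "(\<integral>\<^sup>+s. ennreal ((norm (x - (1/4 * (\<beta> * \<gamma> s)) *\<^sub>R G s (x - (\<beta> * \<gamma> s) *\<^sub>R G s x) - y))\<^sup>2) \<partial>D)
      \<le> ennreal ((1 - \<beta> * (1/8 * (\<integral>s. m s \<partial>D))) * (norm (x - y))\<^sup>2
          + 3/4 * \<beta>\<^sup>2 * (\<integral>s. (\<gamma> s)\<^sup>2 * (norm (G s y))\<^sup>2 \<partial>D))"
proof -
  interpret prob_space D by (rule D)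
  define e where "e = x - y"
  define h where "h = (\<lambda>s. (norm e)\<^sup>2 - \<beta> / 4 * m s * (norm e)\<^sup>2
      - \<beta> / 2 * inner (\<gamma> s *\<^sub>R G s y) e + 3/4 * \<beta>\<^sup>2 * ((\<gamma> s)\<^sup>2 * (norm (G s y))\<^sup>2))"
  have pointwise: "(norm (x - (1/4 * (\<beta> * \<gamma> s)) *\<^sub>R G s (x - (\<beta> * \<gamma> s) *\<^sub>R G s x) - y))\<^sup>2 \<le> h s"
    if s: "s \<in> space D" for s
  proof -
    define c where "c = \<beta> * \<gamma> s"
    have c: "c > 0" using \<beta> \<gamma>_pos[OF s] by (simp add: c_def)
    define u where "u = c *\<^sub>R G s x"
    define v where "v = c *\<^sub>R G s (x - u)"
    define a where "a = c *\<^sub>R G s y"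
    have L: "L s \<ge> 0" using lipschitz_on_nonneg[OF lipschitz[OF s]] .
    have "norm (u - v) = c * dist (G s x) (G s (x - u))"
      using c by (simp add: u_def v_def dist_norm flip: scaleR_diff_right)
    also have "\<dots> \<le> c * (L s * dist x (x - u))"
      using c by (intro mult_left_mono lipschitz_onD[OF lipschitz[OF s]]) auto
    finally have lip: "norm (u - v) \<le> (c * L s) * norm u"
      by (simp add: dist_norm)
    have "inner (v - a) (e - u) = c * inner (G s (x - u) - G s y) ((x - u) - y)"
      by (simp add: v_def a_def e_def algebra_simps)
    also have "\<dots> \<ge> c * (\<mu> s * (norm ((x - u) - y))\<^sup>2)"
      using c monotone[OF s] by (intro mult_left_mono) auto
    finally have mono: "inner (v - a) (e - u) \<ge> (c * \<mu> s) * (norm (e - u))\<^sup>2"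
      by (simp add: e_def algebra_simps)
    have "4 * \<bar>c * \<mu> s\<bar> + sqrt 2 * (c * L s) = \<beta> * (\<gamma> s * (4 * \<bar>\<mu> s\<bar> + sqrt 2 * L s))"
      using c by (simp add: abs_mult) (simp add: c_def algebra_simps)
    also have "\<dots> \<le> 1"
      using \<beta> \<gamma>_pos[OF s] L by (intro mult_le_one[OF _ _ small[OF s]]) auto
    finally have "(norm (e - (1/4) *\<^sub>R v))\<^sup>2
       \<le> (norm e)\<^sup>2 - 1/4 * ((c * \<mu> s) * (of_bool (c * \<mu> s \<ge> 0) + 4 * of_bool (c * \<mu> s < 0))) * (norm e)\<^sup>2
         - 1/2 * inner a e + 3/4 * (norm a)\<^sup>2"
      using lip mono c L by (intro extragradient_step_bound[where t = "c * L s"]) auto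
    also have "\<dots> = h s"
    proof -
      have "c * \<mu> s \<ge> 0 \<longleftrightarrow> \<mu> s \<ge> 0" "c * \<mu> s < 0 \<longleftrightarrow> \<mu> s < 0"
        using c by (auto simp: zero_le_mult_iff mult_less_0_iff)
      then show ?thesis
        by (simp add: h_def m_def a_def c_def power_mult_distrib)
    qed
    also have "e - (1/4) *\<^sub>R v = x - (1/4 * (\<beta> * \<gamma> s)) *\<^sub>R G s (x - (\<beta> * \<gamma> s) *\<^sub>R G s x) - y"
      by (simp add: e_def v_def u_def c_def)
    finally show ?thesis .
  qed
  have inner_int: "integrable D (\<lambda>s. inner (\<gamma> s *\<^sub>R G s y) e)"
    using a_int by (rule integrable_inner_left)
  have h_int: "integrable D h"
    unfolding h_def
    by (intro Bochner_Integration.integrable_add Bochner_Integration.integrable_diff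
        integrable_mult_right integrable_mult_left m_int inner_int a2_int integrable_const)
  have "(\<integral>s. h s \<partial>D) = (norm e)\<^sup>2 - \<beta> / 4 * (\<integral>s. m s \<partial>D) * (norm e)\<^sup>2
      - \<beta> / 2 * (\<integral>s. inner (\<gamma> s *\<^sub>R G s y) e \<partial>D)
      + 3/4 * \<beta>\<^sup>2 * (\<integral>s. (\<gamma> s)\<^sup>2 * (norm (G s y))\<^sup>2 \<partial>D)"
    unfolding h_def using m_int inner_int a2_int
    by (subst Bochner_Integration.integral_add Bochner_Integration.integral_diff,
        (intro Bochner_Integration.integrable_add Bochner_Integration.integrable_diff
          integrable_mult_right integrable_mult_left m_int inner_int a2_int integrable_const)+)+
      (simp add: prob_space)
  also have "(\<integral>s. inner (\<gamma> s *\<^sub>R G s y) e \<partial>D) = 0"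
    using a_int unbiased by (subst integral_inner_left) auto
  finally have h_eq: "(\<integral>s. h s \<partial>D) = (norm e)\<^sup>2 - \<beta> / 4 * (\<integral>s. m s \<partial>D) * (norm e)\<^sup>2
      + 3/4 * \<beta>\<^sup>2 * (\<integral>s. (\<gamma> s)\<^sup>2 * (norm (G s y))\<^sup>2 \<partial>D)" by simp
  have "\<beta> * (\<integral>s. m s \<partial>D) * (norm e)\<^sup>2 \<ge> 0"
    using \<beta> m_nonneg by simp
  then have h_le: "(\<integral>s. h s \<partial>D) \<le> (1 - \<beta> * (1/8 * (\<integral>s. m s \<partial>D))) * (norm e)\<^sup>2
          + 3/4 * \<beta>\<^sup>2 * (\<integral>s. (\<gamma> s)\<^sup>2 * (norm (G s y))\<^sup>2 \<partial>D)"
    unfolding h_eq by (simp add: algebra_simps)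
  have "(\<integral>\<^sup>+s. ennreal ((norm (x - (1/4 * (\<beta> * \<gamma> s)) *\<^sub>R G s (x - (\<beta> * \<gamma> s) *\<^sub>R G s x) - y))\<^sup>2) \<partial>D)
      \<le> (\<integral>\<^sup>+s. ennreal (h s) \<partial>D)"
    by (intro nn_integral_mono ennreal_leI pointwise)
  also have "\<dots> = ennreal (\<integral>s. h s \<partial>D)"
    using h_int by (intro nn_integral_eq_integral AE_I2 order_trans[OF zero_le_power2 pointwise])
  also have "\<dots> \<le> ennreal ((1 - \<beta> * (1/8 * (\<integral>s. m s \<partial>D))) * (norm e)\<^sup>2
          + 3/4 * \<beta>\<^sup>2 * (\<integral>s. (\<gamma> s)\<^sup>2 * (norm (G s y))\<^sup>2 \<partial>D))"
    by (intro ennreal_leI h_le)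
  finally show ?thesis by (simp add: e_def)
qed

section \<open>The stepsize recurrence\<close>

text \<open>
  The number \<open>c / q\<close> is the fixed point of the affine recursion; the excess contracts by \<open>1 - q\<close>.
\<close>

lemma constant_step_recurrence:
  fixes r :: "nat \<Rightarrow> real"
  assumes q: "0 < q" "q \<le> 1"
    and step: "\<And>k. k < n \<Longrightarrow> r (Suc k) \<le> (1 - q) * r k + c"
    and c: "0 \<le> c" and r0: "0 \<le> r 0"
  shows "r n \<le> exp (- (q * real n)) * r 0 + c / q"
proof -
  have "k \<le> n \<Longrightarrow> r k \<le> (1 - q) ^ k * r 0 + c / q" for k
  proof (induction k)
    case 0
    then show ?case using q c by simp
  next
    case (Suc k)
    have "r (Suc k) \<le> (1 - q) * r k + c" using Suc.prems by (intro step) auto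
    also have "\<dots> \<le> (1 - q) * ((1 - q) ^ k * r 0 + c / q) + c"
      using Suc q by (intro add_right_mono mult_left_mono) auto
    also have "\<dots> = (1 - q) ^ Suc k * r 0 + c / q"
      using q by (simp add: field_simps)
    finally show ?case .
  qed
  from this[of n] have "r n \<le> (1 - q) ^ n * r 0 + c / q" by simp
  also have "(1 - q) ^ n \<le> exp (- q) ^ n"
    using q exp_ge_add_one_self[of "- q"] by (intro power_mono) auto
  also have "exp (- q) ^ n = exp (- (q * real n))"
    by (simp add: mult.commute flip: exp_of_nat_mult)
  finally show ?thesis using r0 by (simp add: mult_right_mono)
qed

text \<open>
  With \<open>w = 2 + \<rho> * j\<close> a step contracts \<open>r j\<close>, up to noise, by \<open>1 - 2 * \<rho> / w\<close>, and
  \<open>w\<^sup>2 * (1 - 2 * \<rho> / w) = w\<^sup>2 - 2 * \<rho> * w \<le> (w - \<rho>)\<^sup>2\<close>, the preceding weight. Hence the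
  weighted sequence grows only by the noise, and \<open>w\<^sup>2\<close> times the noise is the constant \<open>4 * c\<close>.
\<close>

lemma decreasing_step_recurrence:
  fixes r :: "nat \<Rightarrow> real"
  assumes \<rho>: "0 < \<rho>" "\<rho> \<le> 1"
    and step: "\<And>j. j < n \<Longrightarrow>
      r (Suc j) \<le> (1 - \<rho> * (2 / (2 + \<rho> * real j))) * r j + c * (2 / (2 + \<rho> * real j))\<^sup>2"
    and r: "\<And>j. 0 \<le> r j" and c: "0 \<le> c"
  shows "(2 + \<rho> * (real n - 1))\<^sup>2 * r n \<le> 4 * r 0 + 4 * c * real n"
proof -
  have "k \<le> n \<Longrightarrow> (2 + \<rho> * (real k - 1))\<^sup>2 * r k \<le> 4 * r 0 + 4 * c * real k" for k
  proof (induction k)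
    case 0
    have "(2 - \<rho>)\<^sup>2 \<le> 2\<^sup>2" using \<rho> by (intro power_mono) auto
    then show ?case using mult_right_mono[OF _ r[of 0]] by simp
  next
    case (Suc k)
    define w where "w = 2 + \<rho> * real k"
    have w: "w > 0" using \<rho> by (simp add: w_def add_pos_nonneg)
    have "w\<^sup>2 * r (Suc k) \<le> w\<^sup>2 * ((1 - \<rho> * (2 / w)) * r k + c * (2 / w)\<^sup>2)"
      using Suc.prems step[of k] by (intro mult_left_mono) (auto simp: w_def)
    also have "\<dots> = (w\<^sup>2 - 2 * \<rho> * w) * r k + 4 * c"
      using w by (simp add: field_simps power2_eq_square)
    also have "\<dots> \<le> (w - \<rho>)\<^sup>2 * r k + 4 * c"
      using r by (intro add_right_mono mult_right_mono) (auto simp: power2_diff)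
    also have "w - \<rho> = 2 + \<rho> * (real k - 1)" by (simp add: w_def algebra_simps)
    also have "(2 + \<rho> * (real k - 1))\<^sup>2 * r k \<le> 4 * r 0 + 4 * c * real k"
      using Suc by simp
    finally show ?case by (simp add: w_def algebra_simps)
  qed
  then show ?thesis by simp
qed

lemma seg_beta_range:
  assumes "\<rho> > 0"
  shows "0 < seg_beta \<rho> K k \<and> seg_beta \<rho> K k \<le> 1"
proof -
  define k0 where "k0 = nat \<lceil>real K / 2\<rceil>"
  have "\<not> k < k0 \<Longrightarrow> \<rho> * (real k - real k0) \<ge> 0" using assms by simp
  then show ?thesis by (auto simp: seg_beta_def Let_def simp flip: k0_def)
qed

text \<open>
  The noise bound \<open>3/4 * s\<close> gives at most \<open>3/4 * s / \<rho>\<close> in the constant regime, which is at most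
  \<open>s / (\<rho>\<^sup>2 * K)\<close> as long as \<open>\<rho> * K \<le> 1\<close>. Otherwise the second half of length \<open>n\<close>, about
  \<open>K/2\<close>, starts from that floor; its weight is at least \<open>(\<rho> * K / 2)\<^sup>2\<close>, and \<open>1 / \<rho> < K\<close> makes
  both noise contributions multiples of \<open>s * K\<close>, for a total of at most \<open>18 * s / (\<rho>\<^sup>2 * K)\<close>.
\<close>

lemma seg_beta_recurrence:
  fixes r :: "nat \<Rightarrow> real"
  assumes \<rho>: "0 < \<rho>" "\<rho> \<le> 1/32"
    and step: "\<And>k. r (Suc k) \<le> (1 - \<rho> * seg_beta \<rho> K k) * r k + 3/4 * s * (seg_beta \<rho> K k)\<^sup>2"
    and r: "\<And>k. 0 \<le> r k" and s: "0 \<le> s" and K: "K > 0"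
  shows "r K \<le> 32 * r 0 / \<rho> * exp (- (\<rho> * real K / 2)) + 27 * s / (\<rho>\<^sup>2 * real K)"
proof -
  define E where "E = r 0 * exp (- (\<rho> * real K / 2))"
  have E: "E \<ge> 0" using r by (simp add: E_def)
  have E_le: "E \<le> 32 * r 0 / \<rho> * exp (- (\<rho> * real K / 2))"
  proof -
    have "1 * E \<le> (32 / \<rho>) * E" using \<rho> E by (intro mult_right_mono) (auto simp: field_simps)
    then show ?thesis by (simp add: E_def)
  qed
  have rK: "\<rho>\<^sup>2 * real K > 0" using \<rho> K by simp
  show ?thesis
  proof (cases "real K \<le> 1 / \<rho>")
    case True
    have "r K \<le> exp (- (\<rho> * real K)) * r 0 + (3/4 * s) / \<rho>"
      using \<rho> s r step True by (intro constant_step_recurrence) (auto simp: seg_beta_def)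
    also have "exp (- (\<rho> * real K)) * r 0 \<le> E"
      unfolding E_def using \<rho> r by (subst mult.commute, intro mult_left_mono) auto
    also have "(3/4 * s) / \<rho> \<le> 27 * s / (\<rho>\<^sup>2 * real K)"
    proof -
      have "s * (\<rho> * real K) \<le> s * 1"
        using True \<rho> s by (intro mult_left_mono) (auto simp: field_simps)
      then have "3/4 * (s * (\<rho> * real K)) \<le> 27 * s" using s by linarith
      then show ?thesis using \<rho> K by (simp add: field_simps power2_eq_square)
    qed
    finally show ?thesis using E_le by simp
  next
    case False
    define k0 where "k0 = nat \<lceil>real K / 2\<rceil>"
    define n where "n = K - k0"
    have k0: "real K / 2 \<le> real k0" "2 * k0 \<le> K + 1" "k0 \<le> K"
      unfolding k0_def using K by linarith+
    have n: "real K - 1 \<le> 2 * real n" "2 * real n \<le> real K" "K = k0 + n"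
      using k0 by (simp_all add: n_def of_nat_diff)
    have start: "r k0 \<le> exp (- (\<rho> * real k0)) * r 0 + (3/4 * s) / \<rho>"
    proof (rule constant_step_recurrence)
      fix k assume "k < k0"
      then have "seg_beta \<rho> K k = 1" by (simp add: seg_beta_def k0_def Let_def)
      then show "r (Suc k) \<le> (1 - \<rho>) * r k + 3/4 * s" using step[of k] by simp
    qed (use \<rho> s r in auto)
    have "exp (- (\<rho> * real k0)) * r 0 \<le> E"
      unfolding E_def using \<rho> r k0
      by (subst mult.commute, intro mult_left_mono) auto
    with start have start': "r k0 \<le> E + (3/4 * s) / \<rho>" by linarith
    have "(2 + \<rho> * (real n - 1))\<^sup>2 * r (k0 + n) \<le> 4 * r (k0 + 0) + 4 * (3/4 * s) * real n"
    proof (rule decreasing_step_recurrence)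
      fix j
      have "seg_beta \<rho> K (k0 + j) = 2 / (2 + \<rho> * real j)"
        using False by (simp add: seg_beta_def k0_def Let_def)
      then show "r (k0 + Suc j) \<le> (1 - \<rho> * (2 / (2 + \<rho> * real j))) * r (k0 + j)
          + 3/4 * s * (2 / (2 + \<rho> * real j))\<^sup>2"
        using step[of "k0 + j"] by simp
    qed (use \<rho> s r in auto)
    then have weighted: "(2 + \<rho> * (real n - 1))\<^sup>2 * r K \<le> 4 * r k0 + 3 * s * real n"
      using n by simp
    have "s * (2 * real n) \<le> s * real K" using n s by (intro mult_left_mono) auto
    then have total: "(2 + \<rho> * (real n - 1))\<^sup>2 * r K \<le> 4 * E + 3 * s / \<rho> + 3/2 * s * real K"
      using weighted start' by simp
    have base: "2 + \<rho> * (real n - 1) \<ge> 1 + \<rho> * real K / 2"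
    proof -
      have "\<rho> * (real K - 1) \<le> \<rho> * (2 * real n)" using n \<rho> by (intro mult_left_mono) auto
      then show ?thesis using \<rho> by (simp add: algebra_simps)
    qed
    define B where "B = 1 + \<rho> * real K / 2"
    have B1: "B \<ge> 1" using \<rho> by (simp add: B_def)
    have "B\<^sup>2 * r K \<le> (2 + \<rho> * (real n - 1))\<^sup>2 * r K"
      using base B1 r by (intro mult_right_mono power_mono) (auto simp: B_def)
    with total have "B\<^sup>2 * r K \<le> 4 * E + (3 * s / \<rho> + 3/2 * s * real K)" by linarith
    then have "r K \<le> (4 * E + (3 * s / \<rho> + 3/2 * s * real K)) / B\<^sup>2"
      using B1 by (simp add: field_simps)
    also have "\<dots> = 4 * E / B\<^sup>2 + (3 * s / \<rho> + 3/2 * s * real K) / B\<^sup>2"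
      by (simp add: add_divide_distrib)
    also have "4 * E / B\<^sup>2 \<le> 4 * E / 1"
      using E B1 by (intro divide_left_mono) auto
    also have "4 * E / 1 \<le> (32 / \<rho>) * E"
    proof -
      have "4 \<le> 32 / \<rho>" using \<rho> by (simp add: field_simps)
      from mult_right_mono[OF this E] show ?thesis by simp
    qed
    also have "(3 * s / \<rho> + 3/2 * s * real K) / B\<^sup>2 \<le> (9/2 * s * real K) / (\<rho> * real K / 2)\<^sup>2"
    proof (rule frac_le)
      have "s * (1 / \<rho>) \<le> s * real K" using False s by (intro mult_left_mono) auto
      then show "3 * s / \<rho> + 3/2 * s * real K \<le> 9/2 * s * real K" by simp
      show "(\<rho> * real K / 2)\<^sup>2 \<le> B\<^sup>2" using \<rho> by (intro power_mono) (auto simp: B_def)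
    qed (use s \<rho> K in auto)
    also have "(9/2 * s * real K) / (\<rho> * real K / 2)\<^sup>2 = 18 * s / (\<rho>\<^sup>2 * real K)"
      using \<rho> K by (simp add: field_simps power2_eq_square)
    also have "18 * s / (\<rho>\<^sup>2 * real K) \<le> 27 * s / (\<rho>\<^sup>2 * real K)"
      using s rK by (intro divide_right_mono) auto
    finally show ?thesis by (simp add: E_def)
  qed
qed

section \<open>Convergence of same-sample extragradient\<close>

theorem corollary3p1:
  fixes M :: "'w measure" and D :: "'s measure"
    and \<xi> :: "nat \<Rightarrow> 'w \<Rightarrow> 's"
    and F :: "real ^ 'd \<Rightarrow> real ^ 'd"
    and F\<xi> :: "'s \<Rightarrow> real ^ 'd \<Rightarrow> real ^ 'd"
    and x0 xstar :: "real ^ 'd"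
    and L \<mu> \<gamma> :: "'s \<Rightarrow> real"
    and \<rho> :: real and \<sigma>2 :: ennreal
    and \<gamma>1 \<gamma>2 :: "nat \<Rightarrow> 's \<Rightarrow> real"
    and K :: nat
  assumes M: "prob_space M"
    and indep: "prob_space.indep_vars M (\<lambda>_. D) \<xi> UNIV"
    and law: "\<And>k. distr M D (\<xi> k) = D"
    and root: "F xstar = 0"
    and meas_F: "\<And>x. (\<lambda>s. F\<xi> s x) \<in> borel_measurable D"
    and meas_\<mu>: "\<mu> \<in> borel_measurable D"
    and meas_\<gamma>: "\<gamma> \<in> borel_measurable D"
    and L_pos: "\<And>s. s \<in> space D \<Longrightarrow> L s > 0"
    and lipschitz: "\<And>s. s \<in> space D \<Longrightarrow> (L s)-lipschitz_on UNIV (F\<xi> s)"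
    and monotone: "\<And>s x. s \<in> space D \<Longrightarrow>
          inner (F\<xi> s x - F\<xi> s xstar) (x - xstar) \<ge> \<mu> s * (norm (x - xstar))\<^sup>2"
    and \<gamma>_pos: "\<And>s. s \<in> space D \<Longrightarrow> \<gamma> s > 0"
    and unbiased_integrable: "integrable D (\<lambda>s. \<gamma> s *\<^sub>R F\<xi> s xstar)"
    and unbiased: "(\<integral>s. \<gamma> s *\<^sub>R F\<xi> s xstar \<partial>D) = 0"
    and average: "(\<integral>s. \<gamma> s * \<mu> s * (of_bool (\<mu> s \<ge> 0) + 4 * of_bool (\<mu> s < 0)) \<partial>D) \<ge> 0"
    and \<gamma>_le: "\<And>s. s \<in> space D \<Longrightarrow> \<gamma> s \<le> 1 / (4 * \<bar>\<mu> s\<bar> + sqrt 2 * L s)"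
    and \<rho>: "\<rho> = 1 / 8 * (\<integral>s. \<gamma> s * \<mu> s * (of_bool (\<mu> s \<ge> 0) + 4 * of_bool (\<mu> s < 0)) \<partial>D)"
    and \<rho>_pos: "\<rho> > 0"
    and \<gamma>1: "\<And>k s. \<gamma>1 k s = seg_beta \<rho> K k * \<gamma> s"
    and \<gamma>2: "\<And>k s. \<gamma>2 k s = 1 / 4 * \<gamma>1 k s"
    and \<sigma>2: "\<sigma>2 = (\<integral>\<^sup>+s. ennreal ((\<gamma> s)\<^sup>2 * (norm (F\<xi> s xstar))\<^sup>2) \<partial>D)"
  shows "(\<integral>\<^sup>+w. ennreal ((norm (s_seg F\<xi> \<gamma>1 \<gamma>2 x0 (\<lambda>k. \<xi> k w) K - xstar))\<^sup>2) \<partial>M)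
       \<le> ennreal (32 * (norm (x0 - xstar))\<^sup>2 / \<rho> * exp (- (\<rho> * real K / 2)))
         + 27 * \<sigma>2 / ennreal (\<rho>\<^sup>2 * real K)"
proof -
  interpret M: prob_space M by (rule M)
  have D: "prob_space D"
    using law[of 0] indep M.prob_space_distr[of "\<xi> 0" D] by (simp add: M.indep_vars_def)
  then interpret D: prob_space D .
  define m where "m = (\<lambda>s. \<gamma> s * \<mu> s * (of_bool (\<mu> s \<ge> 0) + 4 * of_bool (\<mu> s < 0)))"
  have small: "\<gamma> s * (4 * \<bar>\<mu> s\<bar> + sqrt 2 * L s) \<le> 1" if s: "s \<in> space D" for s
  proof -
    have "4 * \<bar>\<mu> s\<bar> + sqrt 2 * L s > 0" using L_pos[OF s] by (simp add: add_nonneg_pos)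
    then show ?thesis using \<gamma>_le[OF s] by (simp add: pos_le_divide_eq)
  qed
  have \<rho>_m: "\<rho> = 1 / 8 * (\<integral>s. m s \<partial>D)" using \<rho> by (simp add: m_def)
  \<comment> \<open>A nonintegrable drift would have integral zero by convention, contradicting \<open>\<rho> > 0\<close>.\<close>
  have m_int: "integrable D m"
    using \<rho>_pos \<rho>_m not_integrable_integral_eq[of D m] by auto
  have "m s \<le> 1/4" if s: "s \<in> space D" for s
  proof (cases "\<mu> s \<ge> 0")
    case True
    have "\<gamma> s * (4 * \<mu> s) \<le> \<gamma> s * (4 * \<bar>\<mu> s\<bar> + sqrt 2 * L s)"
      using \<gamma>_pos[OF s] L_pos[OF s] True by (intro mult_left_mono) auto
    then show ?thesis using small[OF s] True by (simp add: m_def)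
  next
    case False
    then have "m s \<le> 0" using \<gamma>_pos[OF s] by (simp add: m_def mult_nonneg_nonpos)
    then show ?thesis by simp
  qed
  then have "(\<integral>s. m s \<partial>D) \<le> 1/4"
    using m_int by (intro D.integral_le_const) auto
  then have \<rho>_le: "\<rho> \<le> 1/32" using \<rho>_m by simp
  have cont: "continuous_on UNIV (F\<xi> s)" if "s \<in> space D" for s
    using lipschitz[OF that] by (rule lipschitz_on_continuous_on)
  have meas1: "\<gamma>1 k \<in> borel_measurable D" and meas2: "\<gamma>2 k \<in> borel_measurable D" for k
    using meas_\<gamma> by (simp_all add: \<gamma>1 \<gamma>2 cong: measurable_cong)
  define R where "R k = (\<integral>\<^sup>+z. ennreal ((norm (s_seg F\<xi> \<gamma>1 \<gamma>2 x0 z k - xstar))\<^sup>2) \<partial>PiM {..<k} (\<lambda>_. D))" for k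
  have goal_R: "(\<integral>\<^sup>+w. ennreal ((norm (s_seg F\<xi> \<gamma>1 \<gamma>2 x0 (\<lambda>k. \<xi> k w) K - xstar))\<^sup>2) \<partial>M) = R K"
    unfolding R_def
    using s_seg_nn_integral_distr[OF M indep law meas_F cont meas1 meas2, of "\<lambda>x. ennreal ((norm (x - xstar))\<^sup>2)"]
    by simp
  have R_0: "R 0 = ennreal ((norm (x0 - xstar))\<^sup>2)"
    by (simp add: R_def prob_space.emeasure_space_1[OF prob_space_PiM] D)
  \<comment> \<open>For \<open>K = 0\<close> the noise term divides by zero and the first term alone has to suffice.\<close>
  consider "K = 0" | "K > 0" "\<sigma>2 = \<top>" | "K > 0" "\<sigma>2 < \<top>"
    using top.not_eq_extremum by blast
  then show ?thesis
  proof cases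
    case 1
    have "1 * (norm (x0 - xstar))\<^sup>2 \<le> 32 / \<rho> * (norm (x0 - xstar))\<^sup>2"
      using \<rho>_pos \<rho>_le by (intro mult_right_mono) (auto simp: field_simps)
    then have "R K \<le> ennreal (32 * (norm (x0 - xstar))\<^sup>2 / \<rho> * exp (- (\<rho> * real K / 2)))"
      unfolding 1 R_0 by (intro ennreal_leI) simp
    then show ?thesis unfolding goal_R by (rule add_increasing2[rotated]) simp
  next
    case 2
    then show ?thesis by (simp add: ennreal_mult_top ennreal_top_divide)
  next
    case 3
    define S where "S = (\<integral>s. (\<gamma> s)\<^sup>2 * (norm (F\<xi> s xstar))\<^sup>2 \<partial>D)"
    have a2_int: "integrable D (\<lambda>s. (\<gamma> s)\<^sup>2 * (norm (F\<xi> s xstar))\<^sup>2)"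
      using 3 meas_F[of xstar] meas_\<gamma> by (intro integrableI_nonneg) (auto simp flip: \<sigma>2)
    have S: "S \<ge> 0" "\<sigma>2 = ennreal S"
      using nn_integral_eq_integral[OF a2_int] by (simp_all add: S_def \<sigma>2)
    \<comment> \<open>The real sequence that satisfies the recurrence with equality dominates the second moments.\<close>
    define r where "r = rec_nat ((norm (x0 - xstar))\<^sup>2)
        (\<lambda>k b. (1 - \<rho> * seg_beta \<rho> K k) * b + 3/4 * S * (seg_beta \<rho> K k)\<^sup>2)"
    have r_0: "r 0 = (norm (x0 - xstar))\<^sup>2"
      and r_Suc: "r (Suc k) = (1 - \<rho> * seg_beta \<rho> K k) * r k + 3/4 * S * (seg_beta \<rho> K k)\<^sup>2" for k
      by (simp_all add: r_def)
    have \<beta>: "0 < seg_beta \<rho> K k" "seg_beta \<rho> K k \<le> 1" for k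
      using seg_beta_range[OF \<rho>_pos] by auto
    have q: "0 \<le> 1 - \<rho> * seg_beta \<rho> K k" for k
      using mult_le_one[of \<rho> "seg_beta \<rho> K k"] \<beta>[of k] \<rho>_le by simp
    have r_nonneg: "0 \<le> r k" for k
      using S q by (induction k) (simp_all add: r_0 r_Suc)
    have "R k \<le> ennreal (r k)" for k
    proof (induction k)
      case 0
      show ?case by (simp add: R_0 r_0)
    next
      case (Suc k)
      have step: "(\<integral>\<^sup>+s. ennreal ((norm (x - \<gamma>2 k s *\<^sub>R F\<xi> s (x - \<gamma>1 k s *\<^sub>R F\<xi> s x) - xstar))\<^sup>2) \<partial>D)
          \<le> ennreal ((1 - \<rho> * seg_beta \<rho> K k) * (norm (x - xstar))\<^sup>2 + 3/4 * S * (seg_beta \<rho> K k)\<^sup>2)" for x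
        using expected_extragradient_step_bound[OF D lipschitz monotone \<gamma>_pos small
            m_int[unfolded m_def] average unbiased_integrable unbiased a2_int \<beta>[of k], of x]
        by (simp add: \<gamma>1 \<gamma>2 \<rho> S_def mult_ac)
      show ?case
        unfolding R_def r_Suc
        by (rule s_seg_second_moment_Suc[OF D meas_F cont meas1 meas2 q _ step r_nonneg Suc.IH[unfolded R_def]])
           (use S in simp_all)
    qed
    then have "R K \<le> ennreal (r K)" .
    also have "\<dots> \<le> ennreal (32 * r 0 / \<rho> * exp (- (\<rho> * real K / 2)) + 27 * S / (\<rho>\<^sup>2 * real K))"
      using 3 S by (intro ennreal_leI seg_beta_recurrence \<rho>_pos \<rho>_le r_nonneg) (auto simp: r_Suc)
    also have "\<dots> = ennreal (32 * r 0 / \<rho> * exp (- (\<rho> * real K / 2))) + ennreal (27 * S / (\<rho>\<^sup>2 * real K))"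
      using \<rho>_pos S r_nonneg by (intro ennreal_plus) auto
    also have "ennreal (27 * S / (\<rho>\<^sup>2 * real K)) = 27 * \<sigma>2 / ennreal (\<rho>\<^sup>2 * real K)"
      using 3 \<rho>_pos S by (subst divide_ennreal[symmetric]) (auto simp: ennreal_mult)
    finally show ?thesis unfolding goal_R r_0 .
  qed
qed

end
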